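(* Let $G$ be a group, let $N\geq 1$ be an integer and let $\chi_1,\ldots,\chi_N$ be $N$ distinct characters of $G$. The solutions $f,g,h,h_1,\ldots,h_N:G\to\mathbb{C}$ of the functional equation $$f(xy)=g(x)h(y)+\sum_{j=1}^{N}\chi_j(x)h_j(y)\quad\text{for all }x,y\in G$$ are exactly the tuples $(f,g,h,h_1,\ldots,h_N)$ of one of the following forms: (1) $f=\sum_{j=1}^{N}a_j\chi_j$, $g$ is arbitrary, $h=0$ and $h_j=a_j\chi_j$ for all $j=1,\ldots,N$, where $a_1,\ldots,a_N\in\mathbb{C}$ are constants; (2) $f=\sum_{j=1}^{N}a_j\chi_j$, $g=\sum_{j=1}^{N}\beta_j\chi_j$, $h\neq 0$ is arbitrary and $h_j=a_j\chi_j-\beta_jh$ for all $j=1,\ldots,N$, where $a_1,\ldots,a_N,\beta_1,\ldots,\beta_N\in\mathbb{C}$ are constants; (3) $f=\alpha b\chi+\sum_{j=1}^{N}b\varphi_{\chi,\chi_j}$, $g=\alpha\chi-\sum_{j=1}^{N}a_j\chi_j+\sum_{j=1}^{N}\varphi_{\chi,\chi_j}$, $h=b\chi$ and $h_j=a_jb\chi+b\varphi_{\chi,\chi_j}$ for all $j=1,\ldots,N$, where $\chi$ is a character of $G$, $\alpha,a_1,\ldots,a_N\in\mathbb{C}$ and $b\in\mathbb{C}\setminus\{0\}$ are constants, and for each $j$ the function $\varphi_{\chi,\chi_j}:G\to\mathbb{C}$ is a solution of $\varphi_{\chi,\chi_j}(xy)=\varphi_{\chi,\chi_j}(x)\chi(y)+\chi_j(x)\varphi_{\chi,\chi_j}(y)$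 for all $x,y\in G$.
   Context: A character of a group $G$ is a homomorphism from $G$ into the multiplicative group $\mathbb{C}^*$ of nonzero complex numbers. "Arbitrary" means an arbitrary function $G\to\mathbb{C}$; $h\neq 0$ means that $h$ is not the zero function. For each $j$, $\varphi_{\chi,\chi_j}$ denotes one and the same function at each occurrence. *)

theory Defs
  imports Complex_Main "HOL-Algebra.Group"
begin

definition complex_mult_group :: "complex monoid" where
  "complex_mult_group = \<lparr>carrier = UNIV - {0}, monoid.mult = (*), one = 1\<rparr>"

text \<open>
  A function on a group with carrier \<open>carrier G\<close> is represented by a total function on the
  underlying type; its values outside the carrier are irrelevant, so equality of functions on the
  group means agreement on the carrier.
\<close>

definition group_character :: "('a, 'b) monoid_scheme \<Rightarrow> ('a \<Rightarrow> complex) \<Rightarrow> bool" where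
  "group_character G \<chi> \<longleftrightarrow> \<chi> \<in> hom G complex_mult_group"

end

theory Submission
  imports Defs
begin

text \<open>
  Expand \<open>f (x \<otimes> y \<otimes> z)\<close> in two ways and compare coefficients as functions of \<open>x\<close>. If
  \<open>h = 0\<close> or \<open>g\<close> lies in the span of the \<open>\<chi>s j\<close>, the term \<open>g x * h y\<close> can be absorbed into the
  \<open>hs j\<close>, and the linear independence of characters leaves \<open>hs j (y \<otimes> z) = \<chi>s j y * hs j z\<close>.
  Otherwise \<open>g\<close> and the \<open>\<chi>s j\<close> are linearly independent; then \<open>h (y \<otimes> z) = \<chi> y * h z\<close> for a
  function \<open>\<chi>\<close>, which is therefore a character, and the coefficients of the \<open>\<chi>s j\<close> give the
  equations for the \<open>\<phi> j\<close>.
\<close>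

section \<open>Elementary properties of characters\<close>

lemma group_character_mult:
  assumes "group_character G \<chi>" "x \<in> carrier G" "y \<in> carrier G"
  shows "\<chi> (x \<otimes>\<^bsub>G\<^esub> y) = \<chi> x * \<chi> y"
  using assms by (auto simp: group_character_def complex_mult_group_def hom_def)

lemma group_character_nonzero:
  assumes "group_character G \<chi>" "x \<in> carrier G"
  shows "\<chi> x \<noteq> 0"
  using assms by (auto simp: group_character_def complex_mult_group_def hom_def)

context group
begin

lemma group_character_one:
  assumes "group_character G \<chi>"
  shows "\<chi> \<one> = 1"
  using group_character_mult[OF assms, of \<one> \<one>] group_character_nonzero[OF assms, of \<one>] by simp

text \<open>Nonvanishing comes for free: the values at an element and at its inverse multiply to
  1.\<close>

lemma group_characterI:
  assumes mult: "\<And>x y. x \<in> carrier G \<Longrightarrow> y \<in> carrier G \<Longrightarrow> \<chi> (x \<otimes> y) = \<chi> x * \<chi> y"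
    and one: "\<chi> \<one> = 1"
  shows "group_character G \<chi>"
proof -
  have "\<chi> x \<noteq> 0" if "x \<in> carrier G" for x
    using mult[of x "inv x"] one that by auto
  then show ?thesis
    using mult by (auto simp: group_character_def complex_mult_group_def hom_def)
qed

section \<open>Linear independence of characters\<close>

text \<open>Dedekind's argument, by induction on \<open>I\<close>: translating the relation by
  \<open>y\<close> and subtracting \<open>\<chi>s i y\<close> times the original removes the term of
  \<open>i\<close>. What remains is a relation over \<open>I\<close> with coefficients
  \<open>c j * (\<chi>s j y - \<chi>s i y)\<close>.\<close>

lemma characters_independent:
  assumes "finite I"
    and "\<forall>j\<in>I. group_character G (\<chi>s j)"
    and "\<forall>i\<in>I. \<forall>j\<in>I. i \<noteq> j \<longrightarrow> (\<exists>x\<in>carrier G. \<chi>s i x \<noteq> \<chi>s j x)"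
    and "\<And>x. x \<in> carrier G \<Longrightarrow> (\<Sum>j\<in>I. c j * \<chi>s j x) = 0"
  shows "\<forall>j\<in>I. c j = 0"
  using assms
proof (induction I arbitrary: c rule: finite_induct)
  case (insert i I)
  have sum0: "c i * \<chi>s i x + (\<Sum>j\<in>I. c j * \<chi>s j x) = 0" if "x \<in> carrier G" for x
    using insert.prems(3)[OF that] insert.hyps by simp
  have cI: "c k = 0" if k: "k \<in> I" for k
  proof -
    \<comment> \<open>The point depends on \<open>k\<close>; it keeps the factor of
      \<open>c k\<close> in the shortened relation nonzero.\<close>
    obtain y where y: "y \<in> carrier G" "\<chi>s k y \<noteq> \<chi>s i y"
      using insert.prems(2) insert.hyps(2) k by (metis insertCI)
    have "(\<Sum>j\<in>I. c j * (\<chi>s j y - \<chi>s i y) * \<chi>s j x) = 0" if x: "x \<in> carrier G" for x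
    proof -
      have chi: "\<chi>s j (y \<otimes> x) = \<chi>s j y * \<chi>s j x" if "j \<in> insert i I" for j
        using insert.prems(1) that x y(1) by (intro group_character_mult) auto
      have "(\<Sum>j\<in>I. c j * (\<chi>s j y - \<chi>s i y) * \<chi>s j x)
          = (\<Sum>j\<in>I. c j * \<chi>s j (y \<otimes> x)) - \<chi>s i y * (\<Sum>j\<in>I. c j * \<chi>s j x)"
        unfolding sum_distrib_left sum_subtractf[symmetric]
        by (intro sum.cong) (auto simp: chi algebra_simps)
      also have "\<dots> = - (c i * \<chi>s i (y \<otimes> x)) + \<chi>s i y * (c i * \<chi>s i x)"
        using sum0[of "y \<otimes> x"] sum0[OF x] x y(1) by (simp add: add_eq_0_iff)
      also have "\<dots> = 0"
        by (simp add: chi)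
      finally show ?thesis .
    qed
    then have "c k * (\<chi>s k y - \<chi>s i y) = 0"
      using insert.IH[of "\<lambda>j. c j * (\<chi>s j y - \<chi>s i y)"] insert.prems k by auto
    then show ?thesis
      using y(2) by simp
  qed
  moreover have "c i = 0"
    using sum0[of \<one>] cI insert.prems(1) by (simp add: group_character_one)
  ultimately show ?case
    by simp
qed simp

text \<open>The form used for functional equations: both sides expand the same function of
  \<open>x\<close>, while the coefficients come from the other variables, held fixed.\<close>

lemma characters_coeffs_unique:
  assumes "finite I"
    and "\<forall>j\<in>I. group_character G (\<chi>s j)"
    and "\<forall>i\<in>I. \<forall>j\<in>I. i \<noteq> j \<longrightarrow> (\<exists>x\<in>carrier G. \<chi>s i x \<noteq> \<chi>s j x)"
    and "\<And>x. x \<in> carrier G \<Longrightarrow> (\<Sum>j\<in>I. \<chi>s j x * c j) = (\<Sum>j\<in>I. \<chi>s j x * d j)"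
    and "j \<in> I"
  shows "c j = d j"
proof -
  have "(\<Sum>j\<in>I. (c j - d j) * \<chi>s j x) = 0" if "x \<in> carrier G" for x
    using assms(4)[OF that] by (simp add: algebra_simps sum_subtractf)
  then show ?thesis
    using characters_independent[OF assms(1-3), of "\<lambda>j. c j - d j"] assms(5) by simp
qed

section \<open>The equation without the product term\<close>

text \<open>Reading \<open>x \<otimes> y\<close> as \<open>(x \<otimes> y) \<otimes> \<one>\<close>
  gives a second expansion in the \<open>\<chi>s j x\<close>. Comparing coefficients determines each
  \<open>hs j\<close> by its value at the identity, and this value is the constant
  \<open>a j\<close>.\<close>

lemma characters_equation_solution:
  assumes fin: "finite I"
    and chi: "\<forall>j\<in>I. group_character G (\<chi>s j)"
    and distinct: "\<forall>i\<in>I. \<forall>j\<in>I. i \<noteq> j \<longrightarrow> (\<exists>x\<in>carrier G. \<chi>s i x \<noteq> \<chi>s j x)"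
    and eq: "\<And>x y. x \<in> carrier G \<Longrightarrow> y \<in> carrier G \<Longrightarrow> f (x \<otimes> y) = (\<Sum>j\<in>I. \<chi>s j x * hs j y)"
  obtains a where "\<forall>x\<in>carrier G. f x = (\<Sum>j\<in>I. a j * \<chi>s j x)"
    and "\<forall>j\<in>I. \<forall>x\<in>carrier G. hs j x = a j * \<chi>s j x"
proof -
  have hs_eq: "hs j y = \<chi>s j y * hs j \<one>" if j: "j \<in> I" and y: "y \<in> carrier G" for j y
  proof (rule characters_coeffs_unique[OF fin chi distinct _ j])
    fix x assume x: "x \<in> carrier G"
    have "(\<Sum>j\<in>I. \<chi>s j x * hs j y) = f (x \<otimes> y \<otimes> \<one>)"
      using eq[OF x y] x y by simp
    also have "\<dots> = (\<Sum>j\<in>I. \<chi>s j (x \<otimes> y) * hs j \<one>)"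
      using eq[of "x \<otimes> y" \<one>] x y by simp
    also have "\<dots> = (\<Sum>j\<in>I. \<chi>s j x * (\<chi>s j y * hs j \<one>))"
      using chi x y by (intro sum.cong) (auto simp: group_character_mult)
    finally show "(\<Sum>j\<in>I. \<chi>s j x * hs j y) = (\<Sum>j\<in>I. \<chi>s j x * (\<chi>s j y * hs j \<one>))" .
  qed
  have "f y = (\<Sum>j\<in>I. hs j \<one> * \<chi>s j y)" if y: "y \<in> carrier G" for y
  proof -
    have "f y = (\<Sum>j\<in>I. \<chi>s j \<one> * hs j y)"
      using eq[of \<one> y] y by simp
    also have "\<dots> = (\<Sum>j\<in>I. hs j \<one> * \<chi>s j y)"
      using chi hs_eq[OF _ y] by (intro sum.cong) (auto simp: group_character_one)
    finally show ?thesis .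
  qed
  then show thesis
    using hs_eq by (intro that[of "\<lambda>j. hs j \<one>"]) (blast, metis mult.commute)
qed

section \<open>The case of \<open>g\<close> outside the span of the characters\<close>

text \<open>If \<open>p\<close> and \<open>q\<close> differed, dividing by \<open>p - q\<close>
  would express \<open>g\<close> through the characters. Once the \<open>g\<close> terms cancel,
  independence of the characters settles the rest.\<close>

lemma coeffs_unique_outside_span:
  assumes fin: "finite I"
    and chi: "\<forall>j\<in>I. group_character G (\<chi>s j)"
    and distinct: "\<forall>i\<in>I. \<forall>j\<in>I. i \<noteq> j \<longrightarrow> (\<exists>x\<in>carrier G. \<chi>s i x \<noteq> \<chi>s j x)"
    and g: "\<nexists>\<beta>. \<forall>x\<in>carrier G. g x = (\<Sum>j\<in>I. \<beta> j * \<chi>s j x)"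
    and eq: "\<And>x. x \<in> carrier G \<Longrightarrow>
      g x * p + (\<Sum>j\<in>I. \<chi>s j x * c j) = g x * q + (\<Sum>j\<in>I. \<chi>s j x * d j)"
  shows "p = q" and "\<forall>j\<in>I. c j = d j"
proof -
  show "p = q"
  proof (rule ccontr)
    assume "p \<noteq> q"
    have "g x = (\<Sum>j\<in>I. (d j - c j) / (p - q) * \<chi>s j x)" if "x \<in> carrier G" for x
    proof -
      have "g x * (p - q) = (\<Sum>j\<in>I. (d j - c j) * \<chi>s j x)"
        using eq[OF that] by (simp add: algebra_simps sum_subtractf)
      then have "g x = (\<Sum>j\<in>I. (d j - c j) * \<chi>s j x) / (p - q)"
        using \<open>p \<noteq> q\<close> by (simp add: eq_divide_eq)
      then show ?thesis
        by (simp add: sum_divide_distrib)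
    qed
    then have "\<exists>\<beta>. \<forall>x\<in>carrier G. g x = (\<Sum>j\<in>I. \<beta> j * \<chi>s j x)"
      by (intro exI[of _ "\<lambda>j. (d j - c j) / (p - q)"]) simp
    with g show False ..
  qed
  then have "(\<Sum>j\<in>I. \<chi>s j x * c j) = (\<Sum>j\<in>I. \<chi>s j x * d j)" if "x \<in> carrier G" for x
    using eq[OF that] by simp
  then show "\<forall>j\<in>I. c j = d j"
    by (auto intro: characters_coeffs_unique[OF fin chi distinct])
qed

text \<open>Associativity gives an addition law for \<open>g\<close>, and coefficient comparison
  then gives one for \<open>h\<close> and each \<open>hs j\<close>. Removing from
  \<open>hs j / b\<close> its multiple of \<open>\<chi>\<close> leaves
  \<open>\<phi> j\<close>.\<close>

lemma equation_solution_outside_span: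
  assumes fin: "finite I"
    and chi: "\<forall>j\<in>I. group_character G (\<chi>s j)"
    and distinct: "\<forall>i\<in>I. \<forall>j\<in>I. i \<noteq> j \<longrightarrow> (\<exists>x\<in>carrier G. \<chi>s i x \<noteq> \<chi>s j x)"
    and g: "\<nexists>\<beta>. \<forall>x\<in>carrier G. g x = (\<Sum>j\<in>I. \<beta> j * \<chi>s j x)"
    and h: "\<exists>x\<in>carrier G. h x \<noteq> 0"
    and eq: "\<And>x y. x \<in> carrier G \<Longrightarrow> y \<in> carrier G \<Longrightarrow>
      f (x \<otimes> y) = g x * h y + (\<Sum>j\<in>I. \<chi>s j x * hs j y)"
  shows "\<exists>\<chi> \<alpha> a b \<phi>. group_character G \<chi> \<and> b \<noteq> 0
    \<and> (\<forall>j\<in>I. \<forall>x\<in>carrier G. \<forall>y\<in>carrier G. \<phi> j (x \<otimes> y) = \<phi> j x * \<chi> y + \<chi>s j x * \<phi> j y)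
    \<and> (\<forall>x\<in>carrier G. f x = \<alpha> * b * \<chi> x + (\<Sum>j\<in>I. b * \<phi> j x))
    \<and> (\<forall>x\<in>carrier G. g x = \<alpha> * \<chi> x - (\<Sum>j\<in>I. a j * \<chi>s j x) + (\<Sum>j\<in>I. \<phi> j x))
    \<and> (\<forall>x\<in>carrier G. h x = b * \<chi> x)
    \<and> (\<forall>j\<in>I. \<forall>x\<in>carrier G. hs j x = a j * b * \<chi> x + b * \<phi> j x)"
proof -
  obtain z0 where z0: "z0 \<in> carrier G" "h z0 \<noteq> 0"
    using h by blast
  \<comment> \<open>\<open>\<chi> y\<close> and \<open>k j y\<close> are the coefficients of
    \<open>g x\<close> and \<open>\<chi>s j x\<close> in \<open>g (x \<otimes> y)\<close>. Dividing
    by \<open>h z0\<close> is safe, whereas \<open>h \<one> \<noteq> 0\<close> is only known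
    later.\<close>
  define \<chi> where "\<chi> y = h (y \<otimes> z0) / h z0" for y
  define k where "k j y = (hs j (y \<otimes> z0) - \<chi>s j y * hs j z0) / h z0" for j y
  have chi_mult: "\<chi>s j (x \<otimes> y) = \<chi>s j x * \<chi>s j y"
    if "j \<in> I" "x \<in> carrier G" "y \<in> carrier G" for j x y
    using chi that by (intro group_character_mult) auto
  \<comment> \<open>Both sides are \<open>f (x \<otimes> y \<otimes> z)\<close>, split before
    \<open>z\<close> and after \<open>x\<close>.\<close>
  have assoc: "g (x \<otimes> y) * h z + (\<Sum>j\<in>I. \<chi>s j x * (\<chi>s j y * hs j z))
      = g x * h (y \<otimes> z) + (\<Sum>j\<in>I. \<chi>s j x * hs j (y \<otimes> z))"
    if "x \<in> carrier G" "y \<in> carrier G" "z \<in> carrier G" for x y z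
  proof -
    have "(\<Sum>j\<in>I. \<chi>s j x * (\<chi>s j y * hs j z)) = (\<Sum>j\<in>I. \<chi>s j (x \<otimes> y) * hs j z)"
      using chi_mult that by (intro sum.cong) auto
    then show ?thesis
      using eq[of "x \<otimes> y" z] eq[of x "y \<otimes> z"] that by (simp add: m_assoc)
  qed
  have g_mult: "g (x \<otimes> y) = g x * \<chi> y + (\<Sum>j\<in>I. \<chi>s j x * k j y)"
    if "x \<in> carrier G" "y \<in> carrier G" for x y
  proof -
    have "g (x \<otimes> y) * h z0 = g x * h (y \<otimes> z0)
        + (\<Sum>j\<in>I. \<chi>s j x * (hs j (y \<otimes> z0) - \<chi>s j y * hs j z0))"
      using assoc[OF that z0(1)] by (simp add: algebra_simps sum_subtractf)
    then have "g (x \<otimes> y) = (g x * h (y \<otimes> z0)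
        + (\<Sum>j\<in>I. \<chi>s j x * (hs j (y \<otimes> z0) - \<chi>s j y * hs j z0))) / h z0"
      using z0(2) by (simp add: eq_divide_eq)
    then show ?thesis
      by (simp add: \<chi>_def k_def add_divide_distrib sum_divide_distrib)
  qed
  \<comment> \<open>Inserting the addition law for \<open>g\<close> turns both sides into
    combinations of \<open>g x\<close> and the \<open>\<chi>s j x\<close>, so coefficients can be
    compared with \<open>y\<close> and \<open>z\<close> fixed.\<close>
  have coeffs: "g x * (\<chi> y * h z) + (\<Sum>j\<in>I. \<chi>s j x * (k j y * h z + \<chi>s j y * hs j z))
      = g x * h (y \<otimes> z) + (\<Sum>j\<in>I. \<chi>s j x * hs j (y \<otimes> z))"
    if "x \<in> carrier G" "y \<in> carrier G" "z \<in> carrier G" for x y z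
    using assoc[OF that] g_mult[OF that(1,2)]
    by (simp add: algebra_simps sum.distrib sum_distrib_left)
  have h_mult: "h (y \<otimes> z) = \<chi> y * h z"
    and hs_mult: "\<forall>j\<in>I. hs j (y \<otimes> z) = k j y * h z + \<chi>s j y * hs j z"
    if "y \<in> carrier G" "z \<in> carrier G" for y z
    using coeffs_unique_outside_span[OF fin chi distinct g coeffs[OF _ that]] by simp_all
  have character: "group_character G \<chi>"
  proof (rule group_characterI)
    fix x y assume "x \<in> carrier G" "y \<in> carrier G"
    then show "\<chi> (x \<otimes> y) = \<chi> x * \<chi> y"
      using h_mult[of x "y \<otimes> z0"] z0 by (simp add: \<chi>_def m_assoc)
  qed (use z0 in \<open>simp add: \<chi>_def\<close>)
  \<comment> \<open>The constants are forced by the desired formulas at the identity, where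
    \<open>\<chi>\<close> is 1 and the equation for \<open>\<phi> j\<close> makes it vanish.\<close>
  define b where "b = h \<one>"
  define a where "a j = hs j \<one> / b" for j
  define \<phi> where "\<phi> j y = hs j y / b - a j * \<chi> y" for j y
  define \<alpha> where "\<alpha> = g \<one> + (\<Sum>j\<in>I. a j)"
  have h_eq: "h y = b * \<chi> y" if "y \<in> carrier G" for y
    using h_mult[of y \<one>] that by (simp add: b_def)
  then have b: "b \<noteq> 0"
    using z0 by auto
  have hs_one: "hs j \<one> = a j * b" for j
    using b by (simp add: a_def)
  have hs_eq: "hs j y = a j * b * \<chi> y + b * \<phi> j y" for j y
    using b by (simp add: \<phi>_def algebra_simps)
  have \<phi>_mult: "\<phi> j (x \<otimes> y) = \<phi> j x * \<chi> y + \<chi>s j x * \<phi> j y"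
    if j: "j \<in> I" and x: "x \<in> carrier G" and y: "y \<in> carrier G" for j x y
  proof -
    \<comment> \<open>Taking the second factor to be the identity expresses \<open>k j\<close>
      through \<open>\<phi> j\<close>. In the addition law for \<open>hs j\<close> the terms
      \<open>a j * \<chi>s j x * b * \<chi> y\<close> then cancel.\<close>
    have "hs j x = k j x * b + \<chi>s j x * (a j * b)"
      using hs_mult[OF x one_closed] j x by (simp add: b_def[symmetric] hs_one)
    then have "b * k j x = b * (a j * \<chi> x + \<phi> j x - \<chi>s j x * a j)"
      by (simp add: hs_eq algebra_simps)
    then have k_eq: "k j x = a j * \<chi> x + \<phi> j x - \<chi>s j x * a j"
      using b by simp
    have "hs j (x \<otimes> y) = k j x * (b * \<chi> y) + \<chi>s j x * hs j y"
      using hs_mult[OF x y] j h_eq[OF y] by simp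
    then have "b * \<phi> j (x \<otimes> y) = b * (\<phi> j x * \<chi> y + \<chi>s j x * \<phi> j y)"
      unfolding k_eq hs_eq group_character_mult[OF character x y] by (simp add: algebra_simps)
    then show ?thesis
      using b by simp
  qed
  have f_eq: "f y = \<alpha> * b * \<chi> y + (\<Sum>j\<in>I. b * \<phi> j y)" if y: "y \<in> carrier G" for y
  proof -
    have "f y = g \<one> * h y + (\<Sum>j\<in>I. \<chi>s j \<one> * hs j y)"
      using eq[of \<one> y] y by simp
    also have "(\<Sum>j\<in>I. \<chi>s j \<one> * hs j y) = (\<Sum>j\<in>I. a j * (b * \<chi> y) + b * \<phi> j y)"
      using chi group_character_one hs_eq by (intro sum.cong) (auto simp: mult.assoc)
    also have "\<dots> = (\<Sum>j\<in>I. a j) * (b * \<chi> y) + (\<Sum>j\<in>I. b * \<phi> j y)"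
      by (simp only: sum.distrib sum_distrib_right)
    finally show ?thesis
      by (simp add: h_eq[OF y] \<alpha>_def algebra_simps)
  qed
  have g_eq: "g x = \<alpha> * \<chi> x - (\<Sum>j\<in>I. a j * \<chi>s j x) + (\<Sum>j\<in>I. \<phi> j x)"
    if x: "x \<in> carrier G" for x
  proof -
    \<comment> \<open>Here the second argument is the identity; equating with the formula for
      \<open>f\<close> allows solving for \<open>g\<close>, since \<open>b\<close> is
      nonzero.\<close>
    have "f x = g x * b + (\<Sum>j\<in>I. \<chi>s j x * (a j * b))"
      using eq[of x \<one>] x by (simp add: b_def[symmetric] hs_one)
    also have "(\<Sum>j\<in>I. \<chi>s j x * (a j * b)) = b * (\<Sum>j\<in>I. a j * \<chi>s j x)"
      by (simp add: sum_distrib_left mult_ac)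
    finally have "b * g x = b * (\<alpha> * \<chi> x - (\<Sum>j\<in>I. a j * \<chi>s j x) + (\<Sum>j\<in>I. \<phi> j x))"
      unfolding f_eq[OF x] sum_distrib_left[symmetric] by (simp add: algebra_simps)
    then show ?thesis
      using b by simp
  qed
  show ?thesis
    by (rule exI[of _ \<chi>], rule exI[of _ \<alpha>], rule exI[of _ a], rule exI[of _ b],
        rule exI[of _ \<phi>], intro conjI ballI)
      ((fact character b \<phi>_mult f_eq g_eq h_eq)+, rule hs_eq)
qed

end

section \<open>Classification of the solutions\<close>

theorem theorem5p2:
  fixes G :: "('a, 'b) monoid_scheme" (structure)
    and N :: nat
    and \<chi>s :: "nat \<Rightarrow> 'a \<Rightarrow> complex"
    and f g h :: "'a \<Rightarrow> complex"
    and hs :: "nat \<Rightarrow> 'a \<Rightarrow> complex"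
  assumes "group G"
    and "N \<ge> 1"
    and "\<forall>j\<in>{1..N}. group_character G (\<chi>s j)"
    and "\<forall>i\<in>{1..N}. \<forall>j\<in>{1..N}. i \<noteq> j \<longrightarrow> (\<exists>x\<in>carrier G. \<chi>s i x \<noteq> \<chi>s j x)"
  shows "(\<forall>x\<in>carrier G. \<forall>y\<in>carrier G.
            f (x \<otimes> y) = g x * h y + (\<Sum>j = 1..N. \<chi>s j x * hs j y))
     \<longleftrightarrow>
       (\<exists>a :: nat \<Rightarrow> complex.
            (\<forall>x\<in>carrier G. f x = (\<Sum>j = 1..N. a j * \<chi>s j x))
          \<and> (\<forall>x\<in>carrier G. h x = 0)
          \<and> (\<forall>j\<in>{1..N}. \<forall>x\<in>carrier G. hs j x = a j * \<chi>s j x))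
     \<or> (\<exists>(a :: nat \<Rightarrow> complex) (\<beta> :: nat \<Rightarrow> complex).
            (\<forall>x\<in>carrier G. f x = (\<Sum>j = 1..N. a j * \<chi>s j x))
          \<and> (\<forall>x\<in>carrier G. g x = (\<Sum>j = 1..N. \<beta> j * \<chi>s j x))
          \<and> (\<exists>x\<in>carrier G. h x \<noteq> 0)
          \<and> (\<forall>j\<in>{1..N}. \<forall>x\<in>carrier G. hs j x = a j * \<chi>s j x - \<beta> j * h x))
     \<or> (\<exists>(\<chi> :: 'a \<Rightarrow> complex) (\<alpha> :: complex) (a :: nat \<Rightarrow> complex) (b :: complex)
          (\<phi> :: nat \<Rightarrow> 'a \<Rightarrow> complex).
            group_character G \<chi>
          \<and> b \<noteq> 0
          \<and> (\<forall>j\<in>{1..N}. \<forall>x\<in>carrier G. \<forall>y\<in>carrier G.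
                \<phi> j (x \<otimes> y) = \<phi> j x * \<chi> y + \<chi>s j x * \<phi> j y)
          \<and> (\<forall>x\<in>carrier G. f x = \<alpha> * b * \<chi> x + (\<Sum>j = 1..N. b * \<phi> j x))
          \<and> (\<forall>x\<in>carrier G. g x = \<alpha> * \<chi> x - (\<Sum>j = 1..N. a j * \<chi>s j x)
                                    + (\<Sum>j = 1..N. \<phi> j x))
          \<and> (\<forall>x\<in>carrier G. h x = b * \<chi> x)
          \<and> (\<forall>j\<in>{1..N}. \<forall>x\<in>carrier G. hs j x = a j * b * \<chi> x + b * \<phi> j x))"
  (is "?eq \<longleftrightarrow> ?S1 \<or> ?S2 \<or> ?S3")
proof -
  interpret group G by fact
  have "?S1 \<or> ?S2 \<or> ?S3" if ?eq
  proof -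
    have eq: "f (x \<otimes> y) = g x * h y + (\<Sum>j = 1..N. \<chi>s j x * hs j y)"
      if "x \<in> carrier G" "y \<in> carrier G" for x y
      using \<open>?eq\<close> that by blast
    \<comment> \<open>The split is by \<open>h\<close> and \<open>g\<close>, not by the families
      themselves: the second and third overlap, for instance when \<open>\<chi>\<close> is one of
      the \<open>\<chi>s j\<close> and all \<open>\<phi> j\<close> vanish.\<close>
    consider "\<forall>x\<in>carrier G. h x = 0"
      | \<beta> where "\<exists>x\<in>carrier G. h x \<noteq> 0" "\<forall>x\<in>carrier G. g x = (\<Sum>j = 1..N. \<beta> j * \<chi>s j x)"
      | "\<exists>x\<in>carrier G. h x \<noteq> 0" "\<nexists>\<beta>. \<forall>x\<in>carrier G. g x = (\<Sum>j = 1..N. \<beta> j * \<chi>s j x)"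
      by blast
    then show ?thesis
    proof cases
      case 1
      then have "f (x \<otimes> y) = (\<Sum>j = 1..N. \<chi>s j x * hs j y)"
        if "x \<in> carrier G" "y \<in> carrier G" for x y
        using eq that by simp
      from characters_equation_solution[OF finite_atLeastAtMost assms(3,4) this]
      obtain a where "\<forall>x\<in>carrier G. f x = (\<Sum>j = 1..N. a j * \<chi>s j x)"
        "\<forall>j\<in>{1..N}. \<forall>x\<in>carrier G. hs j x = a j * \<chi>s j x" .
      with 1 have ?S1
        by (intro exI[of _ a] conjI)
      then show ?thesis ..
    next
      case (2 \<beta>)
      \<comment> \<open>The product term is absorbed: \<open>hs j + \<beta> j * h\<close> takes the
        role of \<open>hs j\<close>.\<close>
      have "f (x \<otimes> y) = (\<Sum>j = 1..N. \<chi>s j x * (hs j y + \<beta> j * h y))"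
        if "x \<in> carrier G" "y \<in> carrier G" for x y
        using eq[OF that] 2(2) that by (simp add: algebra_simps sum.distrib sum_distrib_left)
      from characters_equation_solution[OF finite_atLeastAtMost assms(3,4) this]
      obtain a where a: "\<forall>x\<in>carrier G. f x = (\<Sum>j = 1..N. a j * \<chi>s j x)"
        "\<forall>j\<in>{1..N}. \<forall>x\<in>carrier G. hs j x + \<beta> j * h x = a j * \<chi>s j x" .
      have ?S2
        by (rule exI[of _ a], rule exI[of _ \<beta>], intro conjI)
          (use 2 a in \<open>simp_all add: eq_diff_eq\<close>)
      then show ?thesis by blast
    next
      case 3
      have ?S3
        by (rule equation_solution_outside_span[OF finite_atLeastAtMost assms(3,4) 3(2,1) eq])
      then show ?thesis by blast
    qed
  qed
  moreover have ?eq if S: ?S1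
  proof -
    obtain a where a: "\<forall>x\<in>carrier G. f x = (\<Sum>j = 1..N. a j * \<chi>s j x)"
      "\<forall>x\<in>carrier G. h x = 0" "\<forall>j\<in>{1..N}. \<forall>x\<in>carrier G. hs j x = a j * \<chi>s j x"
      using S by blast
    show ?thesis
      using a assms(3) by (auto simp: group_character_mult mult_ac intro!: sum.cong)
  qed
  moreover have ?eq if S: ?S2
  proof -
    obtain a \<beta> where a: "\<forall>x\<in>carrier G. f x = (\<Sum>j = 1..N. a j * \<chi>s j x)"
      "\<forall>x\<in>carrier G. g x = (\<Sum>j = 1..N. \<beta> j * \<chi>s j x)"
      "\<forall>j\<in>{1..N}. \<forall>x\<in>carrier G. hs j x = a j * \<chi>s j x - \<beta> j * h x"
      using S by blast
    show ?thesis
    proof (intro ballI)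
      fix x y assume xy: "x \<in> carrier G" "y \<in> carrier G"
      have "f (x \<otimes> y) = (\<Sum>j = 1..N. a j * \<chi>s j (x \<otimes> y))"
        using a(1) xy by simp
      also have "\<dots> = (\<Sum>j = 1..N. \<beta> j * \<chi>s j x * h y + \<chi>s j x * hs j y)"
      proof (intro sum.cong refl)
        fix j assume j: "j \<in> {1..N}"
        have chi_mult: "\<chi>s j (x \<otimes> y) = \<chi>s j x * \<chi>s j y"
          using assms(3) j xy by (intro group_character_mult) auto
        have hs: "hs j y = a j * \<chi>s j y - \<beta> j * h y"
          using a(3) j xy by simp
        show "a j * \<chi>s j (x \<otimes> y) = \<beta> j * \<chi>s j x * h y + \<chi>s j x * hs j y"
          unfolding chi_mult hs by (simp add: algebra_simps)
      qed
      also have "\<dots> = g x * h y + (\<Sum>j = 1..N. \<chi>s j x * hs j y)"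
        using a(2) xy by (simp add: sum.distrib sum_distrib_right)
      finally show "f (x \<otimes> y) = g x * h y + (\<Sum>j = 1..N. \<chi>s j x * hs j y)" .
    qed
  qed
  moreover have ?eq if S: ?S3
  proof -
    obtain \<chi> \<alpha> a b \<phi> where \<chi>: "group_character G \<chi>"
      and \<phi>: "\<forall>j\<in>{1..N}. \<forall>x\<in>carrier G. \<forall>y\<in>carrier G.
                \<phi> j (x \<otimes> y) = \<phi> j x * \<chi> y + \<chi>s j x * \<phi> j y"
      and f: "\<forall>x\<in>carrier G. f x = \<alpha> * b * \<chi> x + (\<Sum>j = 1..N. b * \<phi> j x)"
      and g: "\<forall>x\<in>carrier G. g x = \<alpha> * \<chi> x - (\<Sum>j = 1..N. a j * \<chi>s j x) + (\<Sum>j = 1..N. \<phi> j x)"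
      and h: "\<forall>x\<in>carrier G. h x = b * \<chi> x"
      and hs: "\<forall>j\<in>{1..N}. \<forall>x\<in>carrier G. hs j x = a j * b * \<chi> x + b * \<phi> j x"
      using S by blast
    show ?thesis
    proof (intro ballI)
      fix x y assume xy: "x \<in> carrier G" "y \<in> carrier G"
      have "f (x \<otimes> y) = \<alpha> * b * (\<chi> x * \<chi> y) + (\<Sum>j = 1..N. b * \<phi> j (x \<otimes> y))"
        using f xy group_character_mult[OF \<chi> xy] by simp
      \<comment> \<open>Adding and subtracting \<open>a j * \<chi>s j x * b * \<chi> y\<close>
        completes \<open>\<chi>s j x * b * \<phi> j y\<close> to
        \<open>\<chi>s j x * hs j y\<close>. The remaining terms, together with
        \<open>\<alpha> * b * \<chi> x * \<chi> y\<close>, form \<open>g x * h y\<close>.\<close>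
      also have "(\<Sum>j = 1..N. b * \<phi> j (x \<otimes> y))
          = (\<Sum>j = 1..N. (\<phi> j x - a j * \<chi>s j x) * (b * \<chi> y) + \<chi>s j x * hs j y)"
        using \<phi> hs xy by (intro sum.cong) (auto simp: algebra_simps)
      also have "\<dots> = ((\<Sum>j = 1..N. \<phi> j x) - (\<Sum>j = 1..N. a j * \<chi>s j x)) * (b * \<chi> y)
          + (\<Sum>j = 1..N. \<chi>s j x * hs j y)"
        by (simp only: sum.distrib sum_distrib_right sum_subtractf[symmetric])
      finally show "f (x \<otimes> y) = g x * h y + (\<Sum>j = 1..N. \<chi>s j x * hs j y)"
        unfolding bspec[OF g xy(1)] bspec[OF h xy(2)] by (simp add: algebra_simps)
    qed
  qed
  ultimately show ?thesis by blast
qed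

end
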